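(* For $M \ge 1$ let $$S = \left\{ \left( \frac{\nu}{m}, \frac{\nu^2}{m} \right) \in \mathbb{R}^2/\mathbb{Z}^2 \ :\ m \in \mathbb{Z},\ M < m \le 2M,\ \nu \in \mathbb{Z}/m\mathbb{Z},\ \nu^3 \equiv 2 \pmod m \right\}.$$ Then for any disc $D$ in $\mathbb{R}^2/\mathbb{Z}^2$ of radius $\frac{1}{M}$ (with respect to the metric induced from the Euclidean metric), $$\#(S \cap D) \ll 1,$$ with an implied constant independent of $M$ and $D$. *)

theory Defs
  imports "HOL-Analysis.Analysis" "HOL-Number_Theory.Cong"
begin

definition int_shift :: "real \<times> real \<Rightarrow> real \<times> real \<Rightarrow> bool" where
  "int_shift x y \<longleftrightarrow> fst x - fst y \<in> \<int> \<and> snd x - snd y \<in> \<int>"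

lemma int_shift_equivp: "equivp int_shift"
proof (rule equivpI)
  show "reflp int_shift"
    by (auto simp: int_shift_def intro!: reflpI)
  show "symp int_shift"
    by (rule sympI, unfold int_shift_def) (metis Ints_minus minus_diff_eq)
  show "transp int_shift"
  proof (rule transpI)
    fix x y z assume "int_shift x y" "int_shift y z"
    then have "fst x - fst y + (fst y - fst z) \<in> \<int>" "snd x - snd y + (snd y - snd z) \<in> \<int>"
      unfolding int_shift_def by (blast intro: Ints_add)+
    then show "int_shift x z"
      by (simp add: int_shift_def)
  qed
qed

quotient_type torus = "real \<times> real" / int_shift
  by (rule int_shift_equivp)

lemma abs_torus_eq_iff: "abs_torus x = abs_torus y \<longleftrightarrow> int_shift x y"
  by (rule torus.abs_eq_iff)

lemma ex_abs_torus: "\<exists>x. p = abs_torus x"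
  by (metis Quotient3_abs_rep Quotient3_torus)

lemma int_shift_translate: "int_shift x y \<Longrightarrow> abs_torus (z + (x - y)) = abs_torus z"
  by (simp add: abs_torus_eq_iff int_shift_def)

lemma int_shift_near:
  assumes "int_shift x y" "dist x y < 1"
  shows "x = y"
proof -
  have "a = b" if "a - b \<in> \<int>" "dist a b < 1" for a b :: real
    using Ints_nonzero_abs_ge1[of "a - b"] that by (force simp: dist_real_def)
  moreover have "dist (fst x) (fst y) < 1" "dist (snd x) (snd y) < 1"
    using assms(2) dist_fst_le[of x y] dist_snd_le[of x y] by linarith+
  ultimately show ?thesis
    using assms(1) by (simp add: int_shift_def prod_eq_iff)
qed

text \<open>
  The quotient metric: the infimum of the Euclidean distances between representatives.
\<close>

instantiation torus :: metric_space
begin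

definition dist_torus :: "torus \<Rightarrow> torus \<Rightarrow> real" where
  "dist_torus p q = setdist {x. abs_torus x = p} {y. abs_torus y = q}"

definition uniformity_torus :: "(torus \<times> torus) filter" where
  "uniformity_torus = (INF e\<in>{0<..}. principal {(p, q). dist p q < e})"

definition open_torus :: "torus set \<Rightarrow> bool" where
  "open_torus U \<longleftrightarrow> (\<forall>p\<in>U. \<forall>\<^sub>F (p', q) in uniformity. p' = p \<longrightarrow> q \<in> U)"

instance
proof
  have near: "\<exists>y. abs_torus y = q \<and> dist x y < e" if "dist (abs_torus x) q < e" for x q e
  proof -
    have "setdist {x'. abs_torus x' = abs_torus x} {y. abs_torus y = q} < e"
      using that by (simp only: dist_torus_def)
    moreover have "{x'. abs_torus x' = abs_torus x} \<noteq> {}" "{y. abs_torus y = q} \<noteq> {}"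
      using ex_abs_torus[of q] by blast+
    ultimately obtain x' y where xy: "abs_torus x' = abs_torus x" "abs_torus y = q" "dist x' y < e"
      by (elim setdist_ltE) blast+
    have "int_shift x x'"
      using xy(1) abs_torus_eq_iff by metis
    then have "abs_torus (y + (x - x')) = q"
      using xy(2) by (simp add: int_shift_translate)
    moreover have "dist x (y + (x - x')) = dist x' y"
      by (simp add: dist_norm algebra_simps)
    ultimately show ?thesis using xy(3) by metis
  qed
  have le: "dist (abs_torus x) (abs_torus y) \<le> dist x y" for x y
    by (simp add: dist_torus_def setdist_le_dist)
  have sym: "dist p q = dist q p" for p q :: torus
    by (simp add: dist_torus_def setdist_sym)
  show "dist p q = 0 \<longleftrightarrow> p = q" for p q :: torus
  proof
    assume "p = q" then show "dist p q = 0"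
      by (simp add: dist_torus_def setdist_refl)
  next
    assume 0: "dist p q = 0"
    obtain x where x: "p = abs_torus x" using ex_abs_torus by blast
    obtain y where y: "abs_torus y = q" "dist x y < 1/2"
      using near[of x q "1/2"] 0 x by auto
    have "x = y"
    proof (rule ccontr)
      assume "x \<noteq> y"
      then obtain z where z: "abs_torus z = q" "dist x z < dist x y"
        using near[of x q "dist x y"] 0 x by auto
      have "dist y z < 1"
        using dist_triangle3[of y z x] y z by simp
      moreover have "int_shift y z"
        using y z abs_torus_eq_iff by metis
      ultimately have "y = z" by (rule int_shift_near[rotated])
      then show False using z by simp
    qed
    then show "p = q" using x y by simp
  qed
  show "dist p q \<le> dist p r + dist q r" for p q r :: torus
  proof (rule field_le_epsilon)
    fix e :: real assume e: "e > 0"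
    obtain z where z: "r = abs_torus z" using ex_abs_torus by blast
    obtain x where x: "abs_torus x = p" "dist z x < dist p r + e/2"
      using near[of z p "dist p r + e/2"] e z sym[of p r] by auto
    obtain y where y: "abs_torus y = q" "dist z y < dist q r + e/2"
      using near[of z q "dist q r + e/2"] e z sym[of q r] by auto
    have "dist p q \<le> dist x y" using le x y by metis
    also have "\<dots> \<le> dist z x + dist z y" by (rule dist_triangle3)
    finally show "dist p q \<le> dist p r + dist q r + e" using x y by simp
  qed
qed (fact uniformity_torus_def open_torus_def)+

end

text \<open>
  A residue class \<open>\<nu>\<close> modulo \<open>m\<close> is given by an arbitrary integer representative; the
  lemma after the definition shows that the resulting point depends only on the class.
\<close>

definition root_points :: "real \<Rightarrow> torus set" where
  "root_points M =
     {abs_torus (real_of_int \<nu> / real_of_int m, (real_of_int \<nu>)\<^sup>2 / real_of_int m) | m \<nu> :: int.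
        M < real_of_int m \<and> real_of_int m \<le> 2 * M \<and> [\<nu> ^ 3 = 2] (mod m)}"

lemma root_point_cong:
  fixes m \<mu> \<nu> :: int
  assumes "[\<mu> = \<nu>] (mod m)" "m \<noteq> 0"
  shows "abs_torus (real_of_int \<mu> / real_of_int m, (real_of_int \<mu>)\<^sup>2 / real_of_int m)
       = abs_torus (real_of_int \<nu> / real_of_int m, (real_of_int \<nu>)\<^sup>2 / real_of_int m)"
proof -
  obtain k where k: "\<mu> = \<nu> + m * k"
    using assms(1) by (metis cong_iff_lin cong_sym)
  have "real_of_int \<mu> / real_of_int m - real_of_int \<nu> / real_of_int m = of_int k"
    using assms(2) by (simp add: k field_simps)
  moreover have "(real_of_int \<mu>)\<^sup>2 / real_of_int m - (real_of_int \<nu>)\<^sup>2 / real_of_int m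
      = of_int (2 * \<nu> * k + m * k\<^sup>2)"
    using assms(2) by (simp add: k field_simps power2_eq_square)
  ultimately show ?thesis
    by (simp only: abs_torus_eq_iff int_shift_def fst_conv snd_conv Ints_of_int)
qed

end

theory Submission
  imports Defs
begin

text \<open>
  Write \<open>\<theta>\<close> for the real cube root of 2. For a root \<open>\<nu>\<close> modulo \<open>m\<close>, the pigeonhole principle gives
  a nonzero \<open>\<alpha> = a + b \<theta> + c \<theta>\<^sup>2\<close> in the ideal \<open>(m, \<theta> - \<nu>)\<close> of \<open>\<int>[\<theta>]\<close> with coefficients
  of size at most \<open>B\<close>, about the cube root of \<open>m\<close>. If the point of \<open>(m', n)\<close> lies within \<open>O(1/M)\<close> of the point
  of \<open>(m, \<nu>)\<close>, then \<open>\<alpha>\<close>, \<open>\<theta> \<alpha>\<close>, \<open>\<theta>\<^sup>2 \<alpha>\<close> are congruent to integers \<open>r\<close>, \<open>r\<^sub>1\<close>, \<open>r\<^sub>2\<close> of size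
  \<open>O(B)\<close> modulo the ideal \<open>(m', \<theta> - n)\<close>. Hence \<open>m'\<close> divides \<open>r\<^sub>1\<^sup>2 - r r\<^sub>2\<close> and \<open>r\<^sub>1 r\<^sub>2 - 2 r\<^sup>2\<close>, which have
  size \<open>O(B\<^sup>2)\<close> and therefore vanish when \<open>B\<close> is large. This forces \<open>r\<^sub>1\<^sup>3 = 2 r\<^sup>3\<close>, so \<open>r = 0\<close>
  and \<open>m'\<close> divides the norm of \<open>\<alpha>\<close>. That norm is nonzero and of size \<open>O(m)\<close>, which leaves boundedly many
  moduli \<open>m'\<close>, and for each of them boundedly many \<open>n\<close>.
\<close>

section \<open>The norm form of \<int>[\<theta>]\<close>

text \<open>The norm of \<open>a + b \<theta> + c \<theta>\<^sup>2\<close> with \<open>\<theta>\<^sup>3 = 2\<close>.\<close>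
definition cubic_norm :: "int \<Rightarrow> int \<Rightarrow> int \<Rightarrow> int" where
  "cubic_norm a b c = a ^ 3 + 2 * b ^ 3 + 4 * c ^ 3 - 6 * a * b * c"

text \<open>One step of the 2-adic descent: division of \<open>a + b \<theta> + c \<theta>\<^sup>2\<close> by \<open>\<theta>\<close>.\<close>
lemma cubic_norm_eq_0_halve:
  assumes "cubic_norm a b c = 0"
  obtains d where "a = 2 * d" "cubic_norm b c d = 0"
proof -
  have "a ^ 3 = 2 * (3 * a * b * c - b ^ 3 - 2 * c ^ 3)"
    using assms by (simp add: cubic_norm_def algebra_simps)
  then have "even (a ^ 3)" by (metis dvd_triv_left)
  then have "even a" by simp
  then obtain d where d: "a = 2 * d" by blast
  have "cubic_norm a b c = 2 * cubic_norm b c d"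
    by (simp add: cubic_norm_def d power_mult_distrib algebra_simps)
  with assms d that show ?thesis by simp
qed

text \<open>Three divisions by \<theta> amount to halving, so \<open>(d, e, f)\<close> is half of
  \<open>(a, b, c)\<close> and infinite descent applies.\<close>

lemma cubic_norm_eq_0:
  assumes "cubic_norm a b c = 0"
  shows "a = 0 \<and> b = 0 \<and> c = 0"
  using assms
proof (induction "nat (\<bar>a\<bar> + \<bar>b\<bar> + \<bar>c\<bar>)" arbitrary: a b c rule: less_induct)
  case less
  obtain d where d: "a = 2 * d" "cubic_norm b c d = 0"
    using less.prems by (rule cubic_norm_eq_0_halve)
  obtain e where e: "b = 2 * e" "cubic_norm c d e = 0"
    using d(2) by (rule cubic_norm_eq_0_halve)
  obtain f where f: "c = 2 * f" "cubic_norm d e f = 0"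
    using e(2) by (rule cubic_norm_eq_0_halve)
  show ?case
  proof (rule ccontr)
    assume "\<not> ?thesis"
    then have "nat (\<bar>d\<bar> + \<bar>e\<bar> + \<bar>f\<bar>) < nat (\<bar>a\<bar> + \<bar>b\<bar> + \<bar>c\<bar>)"
      using d(1) e(1) f(1) by auto
    then have "d = 0 \<and> e = 0 \<and> f = 0" using less.hyps f(2) by blast
    with \<open>\<not> ?thesis\<close> d e f show False by simp
  qed
qed

text \<open>The norm is \<alpha> times the product of its other conjugates, which lies in
  \<int>[\<theta>]. Putting \<open>n\<close> for \<theta> changes this identity only by a multiple
  of \<open>n ^ 3 - 2\<close>.\<close>

lemma cubic_norm_dvd:
  fixes m n :: int
  assumes "[n ^ 3 = 2] (mod m)" "m dvd a + b * n + c * n\<^sup>2"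
  shows "m dvd cubic_norm a b c"
proof -
  have "cubic_norm a b c =
      (a + b * n + c * n\<^sup>2) * ((a\<^sup>2 - 2 * b * c) + (2 * c\<^sup>2 - a * b) * n + (b\<^sup>2 - a * c) * n\<^sup>2)
      - (n ^ 3 - 2) * ((b ^ 3 + 2 * c ^ 3 - 2 * a * b * c) + c * (b\<^sup>2 - a * c) * n)"
    unfolding cubic_norm_def by (simp add: algebra_simps power2_eq_square power3_eq_cube)
  moreover have "m dvd n ^ 3 - 2" using assms(1) by (simp add: cong_iff_dvd_diff)
  ultimately show ?thesis using assms(2) by simp
qed

lemma abs_mult3_le:
  fixes x y z :: int
  assumes "\<bar>x\<bar> \<le> B" "\<bar>y\<bar> \<le> B" "\<bar>z\<bar> \<le> B"
  shows "\<bar>x * y * z\<bar> \<le> B ^ 3"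
  using assms unfolding abs_mult power3_eq_cube
  by (intro mult_mono) auto

text \<open>13 = 1 + 2 + 4 + 6, the sum of the absolute coefficients.\<close>

lemma abs_cubic_norm_le:
  assumes "\<bar>a\<bar> \<le> B" "\<bar>b\<bar> \<le> B" "\<bar>c\<bar> \<le> B"
  shows "\<bar>cubic_norm a b c\<bar> \<le> 13 * B ^ 3"
  using abs_mult3_le[OF assms(1,1,1)] abs_mult3_le[OF assms(2,2,2)]
    abs_mult3_le[OF assms(3,3,3)] abs_mult3_le[OF assms]
  unfolding cubic_norm_def power3_eq_cube by linarith

section \<open>Short elements of the ideal\<close>

lemma short_vector:
  fixes m \<nu> :: int and B :: nat
  assumes "m > 0" "m < (int B + 1) ^ 3"
  obtains a b c where "m dvd a + b * \<nu> + c * \<nu>\<^sup>2" "\<bar>a\<bar> \<le> int B" "\<bar>b\<bar> \<le> int B" "\<bar>c\<bar> \<le> int B"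
    "(a, b, c) \<noteq> (0, 0, 0)"
proof -
  \<comment> \<open>The box has more than \<open>m\<close> triples, so two share a residue; their
    difference has entries of size at most \<open>B\<close>.\<close>
  define X where "X = {0..int B} \<times> {0..int B} \<times> {0..int B}"
  define f where "f = (\<lambda>(a, b, c). (a + b * \<nu> + c * \<nu>\<^sup>2) mod m)"
  have "int (card {0..<m}) < (int B + 1) ^ 3" using assms by simp
  also have "\<dots> = int (card X)"
    by (simp add: X_def card_cartesian_product power3_eq_cube algebra_simps)
  finally have card: "card {0..<m} < card X" by (simp only: of_nat_less_iff)
  have "f ` X \<subseteq> {0..<m}" using assms(1) by (auto simp: f_def)
  then have "card (f ` X) \<le> card {0..<m}" by (intro card_mono) auto
  with card have "\<not> inj_on f X" by (intro pigeonhole) simp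
  then obtain p q where "p \<in> X" "q \<in> X" "p \<noteq> q" "f p = f q"
    unfolding inj_on_def by blast
  moreover obtain a b c a' b' c' where "p = (a, b, c)" "q = (a', b', c')"
    by (metis prod_cases3)
  ultimately have *: "(a, b, c) \<in> X" "(a', b', c') \<in> X"
      "(a, b, c) \<noteq> (a', b', c')" "f (a, b, c) = f (a', b', c')"
    by simp_all
  then have "m dvd (a + b * \<nu> + c * \<nu>\<^sup>2) - (a' + b' * \<nu> + c' * \<nu>\<^sup>2)"
    by (simp add: f_def mod_eq_dvd_iff)
  then have "m dvd (a - a') + (b - b') * \<nu> + (c - c') * \<nu>\<^sup>2"
    by (simp add: algebra_simps)
  then show thesis using that * by (auto simp: X_def)
qed

lemma ex_cube_root_floor:
  fixes m :: int
  assumes "m > 0"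
  obtains B :: nat where "int B ^ 3 \<le> m" "m < (int B + 1) ^ 3"
proof -
  let ?P = "\<lambda>k::nat. m < (int k + 1) ^ 3"
  have "m < m + 1" by simp
  also have "\<dots> \<le> (m + 1) ^ 3" using assms by (intro self_le_power) auto
  finally have "?P (nat m)" using assms by simp
  then have P: "?P (LEAST k. ?P k)" by (rule LeastI)
  define B where "B = (LEAST k. ?P k)"
  have "int B ^ 3 \<le> m"
  proof (cases B)
    case 0 then show ?thesis using assms by simp
  next
    case (Suc k)
    then have "\<not> ?P k" using not_less_Least[of k ?P] unfolding B_def by simp
    then show ?thesis using Suc by (simp add: add.commute)
  qed
  with P that show thesis unfolding B_def by blast
qed

section \<open>Passing to a nearby modulus\<close>

text \<open>The integer \<open>l\<close> accounts for the second torus coordinate being defined only modulo 1.\<close>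
lemma small_residue:
  fixes a b c m m' \<nu> n l B :: int and M :: real
  assumes M: "M \<ge> 1" "M < m" "m \<le> 2 * M" "M < m'" "m' \<le> 2 * M"
    and near: "\<bar>n / m' - \<nu> / m\<bar> \<le> 3 / M" "\<bar>(real_of_int n)\<^sup>2 / m' + l - (real_of_int \<nu>)\<^sup>2 / m\<bar> \<le> 3 / M"
    and dvd: "m dvd a + b * \<nu> + c * \<nu>\<^sup>2"
    and B: "\<bar>a\<bar> \<le> 2 * B" "\<bar>b\<bar> \<le> 2 * B" "\<bar>c\<bar> \<le> 2 * B"
  obtains r where "[a + b * n + c * n\<^sup>2 = r] (mod m')" "\<bar>r\<bar> \<le> 28 * B"
proof -
  obtain t where t: "a + b * \<nu> + c * \<nu>\<^sup>2 = m * t" using dvd by blast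
  \<comment> \<open>Chosen so that \<open>r / m'\<close> is the linear form with coefficients
    \<open>a\<close>, \<open>b\<close>, \<open>c\<close> in the small differences \<open>d0\<close>,
    \<open>d1\<close>, \<open>d2\<close>; the term \<open>c * l\<close> absorbs the shift in
    \<open>d2\<close>.\<close>
  define r where "r = a + b * n + c * n\<^sup>2 - m' * (t - c * l)"
  have pos: "real_of_int m > 0" "real_of_int m' > 0" using M by linarith+
  define d0 where "d0 = 1 / real_of_int m' - 1 / m"
  define d1 where "d1 = real_of_int n / m' - \<nu> / m"
  define d2 where "d2 = real_of_int n ^ 2 / m' + l - \<nu>\<^sup>2 / m"
  have "1 / real_of_int m \<le> 1 / M" "1 / real_of_int m' \<le> 1 / M"
    using M by (auto intro!: divide_left_mono)
  moreover have "1 / real_of_int m > 0" "1 / real_of_int m' > 0" using pos by auto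
  ultimately have d0: "\<bar>d0\<bar> \<le> 1 / M" unfolding d0_def by linarith
  have teq: "real_of_int t = (a + b * \<nu> + c * \<nu>\<^sup>2) / m"
    using arg_cong[OF t, of real_of_int] pos by (simp add: field_simps)
  have "real_of_int r / m' = a * d0 + b * d1 + c * d2"
    unfolding r_def d0_def d1_def d2_def of_int_diff of_int_mult of_int_add of_int_power teq
    using pos by (simp add: field_simps)
  moreover have B': "\<bar>real_of_int a\<bar> \<le> 2 * B" "\<bar>real_of_int b\<bar> \<le> 2 * B" "\<bar>real_of_int c\<bar> \<le> 2 * B"
    using B by linarith+
  have "\<bar>a * d0\<bar> \<le> 2 * B * (1 / M)" "\<bar>b * d1\<bar> \<le> 2 * B * (3 / M)" "\<bar>c * d2\<bar> \<le> 2 * B * (3 / M)"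
    unfolding abs_mult using B' near d0 M by (intro mult_mono; simp add: d1_def d2_def)+
  ultimately have "\<bar>real_of_int r / m'\<bar> \<le> 2 * B * (1 / M) + 2 * B * (3 / M) + 2 * B * (3 / M)"
    by linarith
  also have "\<dots> = 14 * B / M" by simp
  finally have "\<bar>real_of_int r\<bar> \<le> 14 * B / M * m'"
    using pos by (simp add: abs_divide divide_le_eq)
  \<comment> \<open>28 = 2 * (1 + 3 + 3) * 2, the last factor from
    \<open>m' \<le> 2 * M\<close>.\<close>
  also have "\<dots> \<le> 14 * B / M * (2 * M)"
    using M B by (intro mult_left_mono) auto
  also have "\<dots> = 28 * B" using M by simp
  finally have "\<bar>r\<bar> \<le> 28 * B" by linarith
  moreover have "[a + b * n + c * n\<^sup>2 = r] (mod m')"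
    unfolding r_def cong_iff_dvd_diff by simp
  ultimately show thesis using that by blast
qed

lemma dvd_small_eq_0:
  fixes m x :: int
  assumes "m dvd x" "\<bar>x\<bar> < m"
  shows "x = 0"
  using assms zdvd_not_zless[of "\<bar>x\<bar>" m] by fastforce

lemma close_modulus_dvd_norm:
  fixes a b c m m' \<nu> n l B :: int and M :: real
  assumes M: "M \<ge> 1" "M < m" "m \<le> 2 * M" "M < m'" "m' \<le> 2 * M"
    and near: "\<bar>n / m' - \<nu> / m\<bar> \<le> 3 / M" "\<bar>(real_of_int n)\<^sup>2 / m' + l - (real_of_int \<nu>)\<^sup>2 / m\<bar> \<le> 3 / M"
    and roots: "[\<nu> ^ 3 = 2] (mod m)" "[n ^ 3 = 2] (mod m')"
    and dvd: "m dvd a + b * \<nu> + c * \<nu>\<^sup>2"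
    and B: "\<bar>a\<bar> \<le> B" "\<bar>b\<bar> \<le> B" "\<bar>c\<bar> \<le> B"
    and large: "2352 * B\<^sup>2 < m'"
  shows "m' dvd cubic_norm a b c"
proof -
  have "2 * c + a * \<nu> + b * \<nu>\<^sup>2 = \<nu> * (a + b * \<nu> + c * \<nu>\<^sup>2) - c * (\<nu> ^ 3 - 2)"
    "2 * b + (2 * c) * \<nu> + a * \<nu>\<^sup>2 = \<nu> * (2 * c + a * \<nu> + b * \<nu>\<^sup>2) - b * (\<nu> ^ 3 - 2)"
    by (simp_all add: algebra_simps power2_eq_square power3_eq_cube)
  moreover have "m dvd \<nu> ^ 3 - 2" using roots(1) by (simp add: cong_iff_dvd_diff)
  ultimately have dvd': "m dvd 2 * c + a * \<nu> + b * \<nu>\<^sup>2" "m dvd 2 * b + (2 * c) * \<nu> + a * \<nu>\<^sup>2"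
    using dvd by simp_all
  note small = small_residue[OF M near]
  obtain r where r: "[a + b * n + c * n\<^sup>2 = r] (mod m')" "\<bar>r\<bar> \<le> 28 * B"
    by (rule small[OF dvd, of B]) (use B in auto)
  obtain r1 where r1: "[2 * c + a * n + b * n\<^sup>2 = r1] (mod m')" "\<bar>r1\<bar> \<le> 28 * B"
    by (rule small[OF dvd'(1), of B]) (use B in auto)
  obtain r2 where r2: "[2 * b + (2 * c) * n + a * n\<^sup>2 = r2] (mod m')" "\<bar>r2\<bar> \<le> 28 * B"
    by (rule small[OF dvd'(2), of B]) (use B in auto)
  let ?x = "a + b * n + c * n\<^sup>2"
  let ?y = "2 * c + a * n + b * n\<^sup>2"
  let ?z = "2 * b + (2 * c) * n + a * n\<^sup>2"
  have n3: "m' dvd n ^ 3 - 2" using roots(2) by (simp add: cong_iff_dvd_diff)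
  have mult_le: "\<bar>u * v\<bar> \<le> 784 * B\<^sup>2" if "\<bar>u\<bar> \<le> 28 * B" "\<bar>v\<bar> \<le> 28 * B" for u v :: int
  proof -
    have "\<bar>u * v\<bar> \<le> (28 * B) * (28 * B)"
      unfolding abs_mult using that by (intro mult_mono) auto
    then show ?thesis by (simp add: power2_eq_square)
  qed
  note bounds = mult_le[OF r(2) r(2)] mult_le[OF r(2) r2(2)] mult_le[OF r1(2) r1(2)]
    mult_le[OF r1(2) r2(2)]
  \<comment> \<open>Modulo \<open>m'\<close>, \<open>?y\<close> is \<open>n * ?x\<close> and
    \<open>?z\<close> is \<open>n\<^sup>2 * ?x\<close>, whence \<open>?y\<^sup>2 = ?x * ?z\<close>
    and, by \<open>n ^ 3 = 2\<close>, \<open>?y * ?z = 2 * ?x\<^sup>2\<close>.\<close>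
  have "?y * ?y - ?x * ?z = (n ^ 3 - 2) * (- 2 * c\<^sup>2 + a * b + (b\<^sup>2 - a * c) * n)"
    by (simp add: algebra_simps power2_eq_square power3_eq_cube)
  then have "[?y * ?y = ?x * ?z] (mod m')"
    using n3 by (simp add: cong_iff_dvd_diff)
  with r r1 r2 have "[r1 * r1 = r * r2] (mod m')"
    by (meson cong_mult cong_sym cong_trans)
  then have "m' dvd r1 * r1 - r * r2" by (simp add: cong_iff_dvd_diff)
  moreover have "\<bar>r1 * r1 - r * r2\<bar> < m'" using bounds large by linarith
  ultimately have "r1 * r1 - r * r2 = 0" by (rule dvd_small_eq_0)
  then have eq1: "r1 * r1 = r * r2" by simp
  have "?y * ?z - 2 * (?x * ?x) = (n ^ 3 - 2) * (a\<^sup>2 - 2 * b * c + (a * b - 2 * c\<^sup>2) * n)"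
    by (simp add: algebra_simps power2_eq_square power3_eq_cube)
  then have "[?y * ?z = 2 * (?x * ?x)] (mod m')"
    using n3 by (simp add: cong_iff_dvd_diff)
  moreover have "[?y * ?z = r1 * r2] (mod m')" "[2 * (?x * ?x) = 2 * (r * r)] (mod m')"
    using r r1 r2 by (auto intro!: cong_mult)
  ultimately have "[r1 * r2 = 2 * (r * r)] (mod m')"
    by (meson cong_sym cong_trans)
  then have "m' dvd r1 * r2 - 2 * (r * r)" by (simp add: cong_iff_dvd_diff)
  \<comment> \<open>The worst case: 784 + 2 * 784 = 2352.\<close>
  moreover have "\<bar>r1 * r2 - 2 * (r * r)\<bar> < m'" using bounds large by linarith
  ultimately have "r1 * r2 - 2 * (r * r) = 0" by (rule dvd_small_eq_0)
  then have eq2: "r1 * r2 = 2 * (r * r)" by simp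
  have "r1 ^ 3 = 2 * r ^ 3"
  proof -
    have "r1 ^ 3 = (r1 * r1) * r1" by (simp add: power3_eq_cube)
    also have "\<dots> = r * (r1 * r2)" unfolding eq1 by simp
    also have "\<dots> = 2 * r ^ 3" unfolding eq2 by (simp add: power3_eq_cube)
    finally show ?thesis .
  qed
  \<comment> \<open>Irrationality of \<theta>, read off from the norm of
    \<open>r1 - r \<theta>\<close>.\<close>
  then have "cubic_norm r1 (- r) 0 = 0" by (simp add: cubic_norm_def)
  then have "r = 0" using cubic_norm_eq_0[of r1 "- r" 0] by simp
  then have "m' dvd ?x" using r(1) by (simp add: cong_iff_dvd_diff)
  then show ?thesis using cubic_norm_dvd roots(2) by blast
qed

section \<open>From torus distance to coordinates\<close>

text \<open>The infimum runs over representatives of both points; translating by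
  \<open>x - x'\<close> keeps the prescribed \<open>x\<close>.\<close>

lemma dist_abs_torus_lessE:
  assumes "dist (abs_torus x) q < e"
  obtains y where "abs_torus y = q" "dist x y < e"
proof -
  have "{x'. abs_torus x' = abs_torus x} \<noteq> {}" "{y. abs_torus y = q} \<noteq> {}"
    using ex_abs_torus[of q] by blast+
  then obtain x' y where xy: "abs_torus x' = abs_torus x" "abs_torus y = q" "dist x' y < e"
    using assms unfolding dist_torus_def by (elim setdist_ltE) blast+
  then have "abs_torus (y + (x - x')) = q"
    using int_shift_translate[of x x' y] by (metis abs_torus_eq_iff)
  moreover have "dist x (y + (x - x')) < e"
    using xy(3) by (simp add: dist_norm algebra_simps)
  ultimately show thesis by (rule that)
qed

definition root_point :: "int \<Rightarrow> int \<Rightarrow> torus" where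
  "root_point m \<nu> = abs_torus (real_of_int \<nu> / real_of_int m, (real_of_int \<nu>)\<^sup>2 / real_of_int m)"

lemma root_point_nearE:
  fixes m m' \<nu> \<mu> :: int
  assumes "dist (root_point m \<nu>) (root_point m' \<mu>) < e" "m' \<noteq> 0"
  obtains n l :: int where "root_point m' n = root_point m' \<mu>" "[n = \<mu>] (mod m')"
    "\<bar>n / m' - \<nu> / m\<bar> \<le> e" "\<bar>(real_of_int n)\<^sup>2 / m' + l - (real_of_int \<nu>)\<^sup>2 / m\<bar> \<le> e"
proof -
  obtain y where y: "abs_torus y = root_point m' \<mu>" "dist (\<nu> / m, (real_of_int \<nu>)\<^sup>2 / m) y < e"
    using assms(1) unfolding root_point_def[of m] by (rule dist_abs_torus_lessE)
  obtain u v where "y = (u, v)" by (cases y)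
  with y have uv: "abs_torus (u, v) = root_point m' \<mu>" "dist (\<nu> / m, (real_of_int \<nu>)\<^sup>2 / m) (u, v) < e"
    by simp_all
  from uv(1) obtain j k where j: "u - \<mu> / m' = of_int j" and k: "v - (real_of_int \<mu>)\<^sup>2 / m' = of_int k"
    unfolding root_point_def abs_torus_eq_iff int_shift_def by (auto elim!: Ints_cases)
  \<comment> \<open>\<open>n\<close> absorbs the integer shift \<open>j\<close> of the first
    coordinate, and \<open>l\<close> corrects for the resulting change
    \<open>2 * \<mu> * j + m' * j\<^sup>2\<close> of the second.\<close>
  define n where "n = \<mu> + m' * j"
  define l where "l = k - 2 * \<mu> * j - m' * j\<^sup>2"
  have n: "[n = \<mu>] (mod m')" by (simp add: n_def cong_iff_dvd_diff)
  then have "root_point m' n = root_point m' \<mu>"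
    unfolding root_point_def using assms(2) by (rule root_point_cong)
  moreover have "n / m' = u" using j assms(2) by (simp add: n_def field_simps)
  moreover have "(real_of_int n)\<^sup>2 / m' + l = v"
    using k assms(2) by (simp add: n_def l_def field_simps power2_eq_square)
  moreover have "\<bar>u - \<nu> / m\<bar> \<le> e" "\<bar>v - (real_of_int \<nu>)\<^sup>2 / m\<bar> \<le> e"
    using uv(2) dist_fst_le[of "(\<nu> / m, (real_of_int \<nu>)\<^sup>2 / m)" "(u, v)"] dist_snd_le[of "(\<nu> / m, (real_of_int \<nu>)\<^sup>2 / m)" "(u, v)"]
    by (auto simp: dist_real_def)
  ultimately show thesis using that[of n l] n by simp
qed

section \<open>Counting moduli and roots\<close>

definition near_moduli :: "real \<Rightarrow> int \<Rightarrow> int \<Rightarrow> int set" where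
  "near_moduli M m \<nu> = {m'. M < real_of_int m' \<and> real_of_int m' \<le> 2 * M \<and>
     (\<exists>n l :: int. [n ^ 3 = 2] (mod m') \<and> \<bar>n / m' - \<nu> / m\<bar> \<le> 3 / M \<and>
        \<bar>(real_of_int n)\<^sup>2 / m' + l - (real_of_int \<nu>)\<^sup>2 / m\<bar> \<le> 3 / M)}"

lemma card_near_moduli_le:
  fixes m \<nu> :: int and M :: real
  assumes M: "M \<ge> 1" "M < m" "m \<le> 2 * M" and root: "[\<nu> ^ 3 = 2] (mod m)"
  shows "finite (near_moduli M m \<nu>) \<and> card (near_moduli M m \<nu>) \<le> 2 * 4704 ^ 3"
proof -
  have bound: ?thesis if "near_moduli M m \<nu> \<subseteq> K" "finite K" "card K \<le> 2 * 4704 ^ 3" for K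
    using that finite_subset card_mono le_trans by metis
  have "m > 0" using M by linarith
  obtain B where B: "int B ^ 3 \<le> m" "m < (int B + 1) ^ 3"
    using ex_cube_root_floor[OF \<open>m > 0\<close>] .
  show ?thesis
  \<comment> \<open>4704 = 2 * 2352: from there on,
    \<open>4704 * B\<^sup>2 \<le> B ^ 3 \<le> m < 2 * m'\<close>. Below it,
    \<open>M < m < 4704 ^ 3\<close> bounds all moduli outright.\<close>
  proof (cases "B < 4704")
    case True
    then have "(int B + 1) ^ 3 \<le> 4704 ^ 3" by (intro power_mono) auto
    with B(2) have "m < 4704 ^ 3" by linarith
    then have "real_of_int m < 4704 ^ 3" by (metis of_int_less_iff of_int_numeral of_int_power)
    then show ?thesis
      using M by (intro bound[of "{1..2 * 4704 ^ 3}"]) (auto simp: near_moduli_def)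
  next
    case False
    obtain a b c where abc: "m dvd a + b * \<nu> + c * \<nu>\<^sup>2"
      "\<bar>a\<bar> \<le> int B" "\<bar>b\<bar> \<le> int B" "\<bar>c\<bar> \<le> int B" "(a, b, c) \<noteq> (0, 0, 0)"
      by (rule short_vector[OF \<open>m > 0\<close> B(2)])
    let ?N = "cubic_norm a b c"
    have "?N \<noteq> 0" using cubic_norm_eq_0 abc(5) by blast
    \<comment> \<open>\<open>m'\<close> is determined by its cofactor \<open>k\<close> in
      \<open>?N\<close>, and \<open>\<bar>?N\<bar> \<le> 13 * B ^ 3 \<le> 26 * m'\<close>.\<close>
    let ?K = "(\<lambda>k. ?N div k) ` {-26..26}"
    show ?thesis
    proof (rule bound[of ?K])
      have "card ?K \<le> card {-26..26::int}" by (rule card_image_le) simp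
      then show "card ?K \<le> 2 * 4704 ^ 3" by simp
    next
      show "near_moduli M m \<nu> \<subseteq> ?K"
      proof
        fix m' assume "m' \<in> near_moduli M m \<nu>"
        then obtain n l :: int where *: "M < real_of_int m'" "m' \<le> 2 * M" "[n ^ 3 = 2] (mod m')"
          "\<bar>n / m' - \<nu> / m\<bar> \<le> 3 / M" "\<bar>(real_of_int n)\<^sup>2 / m' + l - (real_of_int \<nu>)\<^sup>2 / m\<bar> \<le> 3 / M"
          unfolding near_moduli_def by blast
        have "m < 2 * m'" "m' > 0" using M * by linarith+
        have "4704 * int B ^ 2 \<le> int B * int B ^ 2"
          using False by (intro mult_right_mono) auto
        also have "\<dots> = int B ^ 3" by (simp add: power2_eq_square power3_eq_cube)
        finally have "2352 * int B ^ 2 < m'" using B(1) \<open>m < 2 * m'\<close> by linarith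
        then have "m' dvd ?N"
          by (rule close_modulus_dvd_norm[OF M *(1,2,4,5) root *(3) abc(1-4)])
        then obtain k where k: "?N = m' * k" by blast
        with \<open>?N \<noteq> 0\<close> have "k \<noteq> 0" by auto
        have "m' * \<bar>k\<bar> = \<bar>?N\<bar>" using k \<open>m' > 0\<close> by (simp add: abs_mult)
        also have "\<dots> \<le> 13 * int B ^ 3" using abc by (intro abs_cubic_norm_le)
        also have "\<dots> \<le> m' * 26" using B(1) \<open>m < 2 * m'\<close> by linarith
        finally have "\<bar>k\<bar> \<le> 26" using \<open>m' > 0\<close> by (simp add: mult_le_cancel_left)
        moreover have "m' = ?N div k" using k \<open>k \<noteq> 0\<close> by simp
        ultimately show "m' \<in> ?K" by (intro image_eqI[of _ _ k]) auto
      qed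
    qed simp
  qed
qed

lemma card_root_points_le:
  fixes m \<nu> :: int and M :: real
  assumes M: "M \<ge> 1" "M < m" "m \<le> 2 * M" and root: "[\<nu> ^ 3 = 2] (mod m)"
    and A: "A \<subseteq> root_points M" "\<And>q. q \<in> A \<Longrightarrow> dist (root_point m \<nu>) q < 3 / M"
  shows "finite A \<and> card A \<le> 2 * 4704 ^ 3 * 14"
proof -
  let ?K = "near_moduli M m \<nu>"
  have K: "finite ?K" "card ?K \<le> 2 * 4704 ^ 3"
    using card_near_moduli_le[OF M root] by auto
  let ?f = "\<lambda>(m', j). root_point m' (\<lfloor>m' * (\<nu> / m)\<rfloor> + j)"
  \<comment> \<open>\<open>n\<close> is within \<open>2 * M * (3 / M) = 6\<close> of
    \<open>m' * (\<nu> / m)\<close>, and the floor adds less than 1.\<close>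
  let ?X = "?K \<times> {-6..7::int}"
  have "A \<subseteq> ?f ` ?X"
  proof
    fix q assume "q \<in> A"
    then have "q \<in> root_points M" and near: "dist (root_point m \<nu>) q < 3 / M" using A by auto
    then obtain m' \<mu> where q: "q = root_point m' \<mu>" "M < real_of_int m'" "m' \<le> 2 * M"
        "[\<mu> ^ 3 = 2] (mod m')"
      unfolding root_points_def root_point_def by blast
    have "m' > 0" using q M by linarith
    then obtain n l :: int where n: "root_point m' n = root_point m' \<mu>" "[n = \<mu>] (mod m')"
      "\<bar>n / m' - \<nu> / m\<bar> \<le> 3 / M" "\<bar>(real_of_int n)\<^sup>2 / m' + l - (real_of_int \<nu>)\<^sup>2 / m\<bar> \<le> 3 / M"
      using root_point_nearE[of m \<nu> m' \<mu> "3 / M"] near q(1) by (metis less_irrefl)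
    have "[n ^ 3 = 2] (mod m')" using n(2) q(4) cong_pow cong_trans by blast
    then have "m' \<in> ?K" using q n unfolding near_moduli_def by blast
    have "real_of_int n - m' * (\<nu> / m) = m' * (n / m' - \<nu> / m)"
      using \<open>m' > 0\<close> by (simp add: field_simps)
    then have "\<bar>real_of_int n - m' * (\<nu> / m)\<bar> = m' * \<bar>n / m' - \<nu> / m\<bar>"
      using \<open>m' > 0\<close> by (simp add: abs_mult)
    also have "\<dots> \<le> (2 * M) * (3 / M)"
      using q n M \<open>m' > 0\<close> by (intro mult_mono) auto
    also have "\<dots> = 6" using M by simp
    finally have "n - \<lfloor>m' * (\<nu> / m)\<rfloor> \<in> {-6..7}"
      unfolding atLeastAtMost_iff by linarith
    moreover have "q = ?f (m', n - \<lfloor>m' * (\<nu> / m)\<rfloor>)" using q n by simp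
    ultimately show "q \<in> ?f ` ?X" using \<open>m' \<in> ?K\<close> by blast
  qed
  moreover have "finite ?X" using K by simp
  ultimately have "finite A" "card A \<le> card ?X"
    by (auto intro: finite_surj surj_card_le)
  moreover have "card ?X = card ?K * 14" by (simp add: card_cartesian_product)
  ultimately show ?thesis using K(2) by linarith
qed

theorem theorem2:
  shows "\<exists>C::real. \<forall>M::real. M \<ge> 1 \<longrightarrow>
           (\<forall>c::torus. finite (root_points M \<inter> cball c (1 / M)) \<and>
                       real (card (root_points M \<inter> cball c (1 / M))) \<le> C)"
proof (intro exI allI impI)
  fix M :: real and c :: torus
  assume M: "M \<ge> 1"
  let ?A = "root_points M \<inter> cball c (1 / M)"
  have "finite ?A \<and> card ?A \<le> 2 * 4704 ^ 3 * 14"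
  proof (cases "?A = {}")
    case False
    then obtain p where p: "p \<in> root_points M" "dist c p \<le> 1 / M" by auto
    then obtain m \<nu> where m: "p = root_point m \<nu>" "M < real_of_int m" "m \<le> 2 * M"
        "[\<nu> ^ 3 = 2] (mod m)"
      unfolding root_points_def root_point_def by blast
    \<comment> \<open>Recentring at \<open>p\<close> costs a factor 2; 3 makes the inequality
      strict, as picking representatives near an infimum requires.\<close>
    have "dist p q < 3 / M" if "q \<in> ?A" for q
    proof -
      have "dist p q \<le> 1 / M + 1 / M"
        using that p(2) dist_triangle3[of p q c] by auto
      also have "\<dots> < 3 / M" using M by (simp add: field_simps)
      finally show ?thesis .
    qed
    with m M show ?thesis by (intro card_root_points_le[of M m \<nu>]) auto
  qed simp
  then show "finite ?A \<and> real (card ?A) \<le> real (2 * 4704 ^ 3 * 14)"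
    using of_nat_mono by blast
qed

end
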